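(* Let $c\in\mathbb{R}$ and let $n>0$ be a real number such that $n>c$ if $c\ge 0$, and $n=-cl$ for some $l\in\mathbb{N}$ if $c<0$. Let $S_{n,c}(x)=\sum_{k=0}^\infty \left(p_{n,k}^{[c]}(x)\right)^2$ for $x\in I_c$. If $c\neq 0$, then for all $x\in I_c$: $$S_{n,c}(x) = (1+cx)^{-\frac{2n}{c}} \sum_{k=0}^\infty \left( \frac{n(n+c)\cdots(n+(k-1)c)}{k!} \right)^2 \left( \frac{x}{1+cx} \right)^{2k},$$ $$S_{n,c}(x) = (1+cx)^{-\frac{2n}{c}}\, {}_2F_1\left( \frac{n}{c},\frac{n}{c};1;\left( \frac{cx}{1+cx} \right)^2 \right),$$ $$S_{n,c}(x) = \frac{1}{\pi}\int_0^1 \left( t+(1-t)(1+2cx)^2 \right)^{-\frac{n}{c}} \frac{dt}{\sqrt{t(1-t)}}.$$ (When $c<0$ and $x=-\frac1c$, the right-hand sides of the first two formulas are understood as their limits as $x\to -\frac1c$ from within $I_c$.) If $c=0$, then for all $x\in I_0=[0,\infty)$: $$S_{n,0}(x) = e^{-2nx}\sum_{k=0}^\infty \frac{(nx)^{2k}}{(k!)^2},$$ $$S_{n,0}(x) = e^{-2nx}I_0(2nx),$$ $$S_{n,0}(x) = \frac{1}{\pi}\int_{-1}^{1}e^{-2nx(1+t)}\frac{dt}{\sqrt{1-t^2}},$$ where, in the second formula, $I_0(\cdot)$ denotes the modified Bessel function of the first kind of order $0$.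
   Context: For $c\in\mathbb{R}$ the interval $I_c$ is $I_c=\left[0,-\frac1c\right]$ if $c<0$ and $I_c=[0,+\infty)$ if $c\ge 0$. For $\alpha\in\mathbb{R}$, $\binom{\alpha}{0}=1$ and $\binom{\alpha}{k}=\frac{\alpha(\alpha-1)\cdots(\alpha-k+1)}{k!}$ for $k\in\mathbb{N}=\{1,2,\dots\}$. For $k\in\mathbb{N}_0=\{0,1,2,\dots\}$ and $x\in I_c$, $$p_{n,k}^{[c]}(x)=(-1)^k\binom{-\frac nc}{k}(cx)^k(1+cx)^{-\frac nc-k}\quad (c\ne 0),\qquad p_{n,k}^{[0]}(x)=\frac{(nx)^k}{k!}e^{-nx}.$$ When $c<0$ and $n=-cl$, one has $-\frac nc=l$, so $p_{n,k}^{[c]}$ is identically $0$ for $k>l$ and is a polynomial for $k\le l$ (with the convention $0^0=1$). The product $n(n+c)\cdots(n+(k-1)c)$ equals $1$ for $k=0$. ${}_2F_1(a,b;1;z)=\sum_{k\ge0}\frac{(a)_k(b)_k}{(1)_k}\frac{z^k}{k!}$ is the Gauss hypergeometric function, with $(a)_k=a(a+1)\cdots(a+k-1)$; it is a polynomial in $z$ when $a$ is a negative integer. The Bessel function is $I_0(z)=\sum_{k\ge 0}\frac{(z/2)^{2k}}{(k!)^2}$ (not to be confused with the interval $I_c$ at $c=0$). *)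

theory Defs
  imports "HOL-Analysis.Analysis"
begin

definition I_dom :: "real \<Rightarrow> real set" where
  "I_dom c = (if c < 0 then {0..- 1 / c} else {0..})"

text \<open>
  Real power of a nonnegative base with the convention \<open>0\<^sup>0 = 1\<close>; the library has
  \<^term>\<open>(0::real) powr 0 = 0\<close>. The convention is needed for \<open>c < 0\<close>, \<open>n = - c l\<close>, \<open>k = l\<close> at the
  right endpoint \<open>x = - 1 / c\<close>. For \<open>k > l\<close> the exponent is negative, but then the binomial
  coefficient vanishes.
\<close>

definition rpow :: "real \<Rightarrow> real \<Rightarrow> real" where
  "rpow b a = (if a = 0 then 1 else b powr a)"

definition p_basis :: "real \<Rightarrow> real \<Rightarrow> nat \<Rightarrow> real \<Rightarrow> real" where
  "p_basis c n k x =
     (if c = 0 then (n * x) ^ k / fact k * exp (- (n * x))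
      else (- 1) ^ k * ((- n / c) gchoose k) * (c * x) ^ k * rpow (1 + c * x) (- n / c - real k))"

definition S_sum :: "real \<Rightarrow> real \<Rightarrow> real \<Rightarrow> real" where
  "S_sum c n x = (\<Sum>k. (p_basis c n k x)\<^sup>2)"

definition hyp_2F1 :: "real \<Rightarrow> real \<Rightarrow> real \<Rightarrow> real \<Rightarrow> real" where
  "hyp_2F1 a b d z = eval_fps (fps_hypergeo [a, b] [d] 1) z"

lemma hyp_2F1_series:
  "hyp_2F1 a b d z =
     (\<Sum>k. pochhammer a k * pochhammer b k / pochhammer d k * (z ^ k / fact k))"
  by (simp add: hyp_2F1_def eval_fps_def)

text \<open>The modified Bessel function of the first kind of order 0.\<close>

definition bessel_I0 :: "real \<Rightarrow> real" where
  "bessel_I0 z = (\<Sum>k. (z / 2) ^ (2 * k) / (fact k)\<^sup>2)"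

text \<open>
  The right-hand sides of the first two formulas for \<open>c \<noteq> 0\<close>. They have their intended meaning
  only where \<open>1 + c x > 0\<close>, that is, on \<open>I_dom c\<close> without the point \<open>- 1 / c\<close>.
\<close>

definition series_coeff :: "real \<Rightarrow> real \<Rightarrow> nat \<Rightarrow> real" where
  "series_coeff c n k = (\<Prod>i<k. n + real i * c) / fact k"

definition series_rhs :: "real \<Rightarrow> real \<Rightarrow> real \<Rightarrow> real" where
  "series_rhs c n x =
     (1 + c * x) powr (- 2 * n / c) *
     (\<Sum>k. (series_coeff c n k)\<^sup>2 * (x / (1 + c * x)) ^ (2 * k))"

definition hyp_rhs :: "real \<Rightarrow> real \<Rightarrow> real \<Rightarrow> real" where
  "hyp_rhs c n x =
     (1 + c * x) powr (- 2 * n / c) * hyp_2F1 (n / c) (n / c) 1 ((c * x / (1 + c * x))\<^sup>2)"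

end

theory Submission
  imports Defs
begin

text \<open>
  The numbers \<open>p\<^sub>k = p_basis c n k x\<close> are the coefficients of the generating function
  \<open>\<Sum>\<^sub>k p\<^sub>k z\<^sup>k = (1 + c x (1 - z)) powr (- n / c)\<close> (respectively \<open>exp (n x (z - 1))\<close> for \<open>c = 0\<close>),
  and the series converges absolutely for \<open>\<bar>z\<bar> \<le> 1\<close>. By Parseval's identity on the unit circle,
  the sum of the squares is the mean of the squared modulus of this function, which depends only on
  \<open>cos \<theta>\<close>; the substitution \<open>t = m - d cos \<theta>\<close> turns the mean over \<open>{0..pi}\<close> into an integral
  with the arcsine weight. For \<open>c \<noteq> 0\<close> this is applied to the coefficients \<open>(- 1)\<^sup>k p\<^sub>k\<close>, which makes
  \<open>t\<close> increasing in \<open>\<theta>\<close>. The series formulas hold term by term, and the limits at \<open>- 1 / c\<close> follow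
  from \<open>S_sum c n\<close> being a polynomial for \<open>c < 0\<close>.
\<close>

section \<open>Orthogonality of cosines and Parseval's identity\<close>

text \<open>Half the circle suffices: with real coefficients the squared modulus expands into
  cosines of integer multiples of \<theta> alone, and each nonconstant one already integrates to 0
  over \<open>{0..pi}\<close> because sine vanishes at integer multiples of pi.\<close>

lemma has_integral_cos_int_multiple:
  fixes i :: int
  shows "((\<lambda>\<theta>. cos (of_int i * \<theta>)) has_integral (if i = 0 then pi else 0)) {0..pi}"
proof (cases "i = 0")
  case True
  then show ?thesis
    using has_integral_const_real[of "1::real" 0 pi] by simp
next
  case False
  have "((\<lambda>\<theta>. cos (of_int i * \<theta>)) has_integral
      (sin (of_int i * pi) / of_int i - sin (of_int i * 0) / of_int i)) {0..pi}"
    by (rule fundamental_theorem_of_calculus)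
      (use False in \<open>auto intro!: derivative_eq_intros
         simp flip: has_real_derivative_iff_has_vector_derivative\<close>)
  moreover have "sin (of_int i * pi) = 0"
    using sin_npi_int[of i] by (simp add: mult.commute)
  ultimately show ?thesis using False by simp
qed

lemma norm_square_trig_sum:
  fixes b :: "nat \<Rightarrow> real"
  shows "(norm (\<Sum>k<N. of_real (b k) * cis \<theta> ^ k))\<^sup>2 =
    (\<Sum>j<N. \<Sum>k<N. b j * b k * cos (of_int (int j - int k) * \<theta>))"
proof -
  have "(norm (\<Sum>k<N. of_real (b k) * cis \<theta> ^ k))\<^sup>2 =
      (\<Sum>k<N. b k * cos (real k * \<theta>))\<^sup>2 + (\<Sum>k<N. b k * sin (real k * \<theta>))\<^sup>2"
    by (simp add: cmod_power2 Complex.DeMoivre)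
  also have "\<dots> = (\<Sum>j<N. \<Sum>k<N. b j * b k * cos (of_int (int j - int k) * \<theta>))"
    by (simp add: power2_eq_square sum_product cos_diff algebra_simps flip: sum.distrib)
  finally show ?thesis .
qed

lemma has_integral_norm_square_trig_sum:
  fixes b :: "nat \<Rightarrow> real"
  shows "((\<lambda>\<theta>. (norm (\<Sum>k<N. of_real (b k) * cis \<theta> ^ k))\<^sup>2) has_integral
    pi * (\<Sum>k<N. (b k)\<^sup>2)) {0..pi}"
proof -
  have "((\<lambda>\<theta>. \<Sum>j<N. \<Sum>k<N. b j * b k * cos (of_int (int j - int k) * \<theta>)) has_integral
      (\<Sum>j<N. \<Sum>k<N. b j * b k * (if int j - int k = 0 then pi else 0))) {0..pi}"
    by (intro has_integral_sum has_integral_mult_right has_integral_cos_int_multiple) auto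
  also have "(\<Sum>j<N. \<Sum>k<N. b j * b k * (if int j - int k = 0 then pi else 0)) =
      (\<Sum>j<N. \<Sum>k<N. if j = k then b j * b k * pi else 0)"
    by (intro sum.cong) auto
  also have "\<dots> = pi * (\<Sum>k<N. (b k)\<^sup>2)"
    by (simp add: sum_distrib_left power2_eq_square algebra_simps)
  finally show ?thesis
    by (simp add: norm_square_trig_sum)
qed

text \<open>The identity is exact for partial sums. Absolute summability bounds all of them by the
  constant \<open>M\<close>, so dominated convergence passes to the limit. Only the limit of the
  squared moduli is assumed, so \<open>w\<close> can be given in real form.\<close>

lemma parseval_sums:
  fixes b :: "nat \<Rightarrow> real" and w :: "real \<Rightarrow> real"
  assumes b: "summable (\<lambda>k. \<bar>b k\<bar>)"
    and w: "\<And>\<theta>. \<theta> \<in> {0..pi} \<Longrightarrow>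
      (\<lambda>N. (norm (\<Sum>k<N. of_real (b k) * cis \<theta> ^ k))\<^sup>2) \<longlonglongrightarrow> w \<theta>"
  shows "(\<lambda>k. (b k)\<^sup>2) sums (1 / pi * integral {0..pi} w)"
proof -
  define M where "M = (\<Sum>k. \<bar>b k\<bar>)"
  define q where "q N \<theta> = (norm (\<Sum>k<N. of_real (b k) * cis \<theta> ^ k))\<^sup>2" for N \<theta>
  have q: "(q N has_integral pi * (\<Sum>k<N. (b k)\<^sup>2)) {0..pi}" for N
    unfolding q_def by (rule has_integral_norm_square_trig_sum)
  have q_le: "norm (q N \<theta>) \<le> M\<^sup>2" for N \<theta>
  proof -
    have "norm (\<Sum>k<N. of_real (b k) * cis \<theta> ^ k) \<le> (\<Sum>k<N. \<bar>b k\<bar>)"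
      by (rule sum_norm_le) (simp add: norm_mult norm_power)
    also have "\<dots> \<le> M"
      unfolding M_def by (rule sum_le_suminf) (use b in auto)
    finally show ?thesis
      unfolding q_def by (simp add: power_mono)
  qed
  have "(\<lambda>N. integral {0..pi} (q N)) \<longlonglongrightarrow> integral {0..pi} w"
  proof (rule dominated_convergence)
    show "(\<lambda>_. M\<^sup>2) integrable_on {0..pi}" by (rule integrable_const_ivl)
  qed (use q q_le w in \<open>auto simp: q_def\<close>)
  then have "(\<lambda>N. pi * (\<Sum>k<N. (b k)\<^sup>2)) \<longlonglongrightarrow> integral {0..pi} w"
    by (simp only: integral_unique[OF q])
  then have "(\<lambda>N. 1 / pi * (pi * (\<Sum>k<N. (b k)\<^sup>2))) \<longlonglongrightarrow> 1 / pi * integral {0..pi} w"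
    by (rule tendsto_mult_left)
  then show ?thesis
    by (simp add: sums_def)
qed

section \<open>The substitution producing the arcsine weight\<close>

text \<open>With \<open>t = m - d * cos \<theta>\<close> the root becomes
  \<open>d * sin \<theta>\<close>, which is also \<open>dt/d\<theta>\<close>, so the weight cancels.
  The weight is unbounded at both ends; nonnegativity of \<open>h\<close> lets the substitution rule
  deliver integrability along with the value.\<close>

lemma arcsine_substitution:
  fixes h :: "real \<Rightarrow> real" and m d :: real
  assumes d: "d > 0" and cont: "continuous_on {m - d..m + d} h"
    and nonneg: "\<And>t. t \<in> {m - d..m + d} \<Longrightarrow> h t \<ge> 0"
  shows "set_integrable lborel {m - d<..<m + d} (\<lambda>t. h t * (1 / sqrt (d\<^sup>2 - (t - m)\<^sup>2)))" (is ?A)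
    and "(LBINT t:{m - d<..<m + d}. h t * (1 / sqrt (d\<^sup>2 - (t - m)\<^sup>2))) =
      integral {0..pi} (\<lambda>\<theta>. h (m - d * cos \<theta>))" (is ?B)
proof -
  define g where "g \<theta> = m - d * cos \<theta>" for \<theta>
  define f where "f t = h t * (1 / sqrt (d\<^sup>2 - (t - m)\<^sup>2))" for t
  have g_in: "g \<theta> \<in> {m - d..m + d}" for \<theta>
    using cos_le_one[of \<theta>] cos_ge_minus_one[of \<theta>] d
      mult_left_mono[of "cos \<theta>" 1 d] mult_left_mono[of "-1" "cos \<theta>" d]
    by (auto simp: g_def)
  have g_sin: "d\<^sup>2 - (g \<theta> - m)\<^sup>2 = (d * sin \<theta>)\<^sup>2" for \<theta>
    by (simp add: g_def power_mult_distrib sin_squared_eq algebra_simps)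
  have g_int: "g \<theta> \<in> {m - d<..<m + d}" if "0 < \<theta>" "\<theta> < pi" for \<theta>
  proof -
    have "(d * sin \<theta>)\<^sup>2 > 0" using d sin_gt_zero[OF that] by simp
    then have "\<bar>g \<theta> - m\<bar>\<^sup>2 < d\<^sup>2" using g_sin[of \<theta>] unfolding power2_abs by linarith
    then have "\<bar>g \<theta> - m\<bar> < d" by (rule power_less_imp_less_base) (use d in simp)
    then show ?thesis using d by auto
  qed
  \<comment> \<open>The cancellation is confined to the open interval: at 0 and pi the left side is
    0, while \<open>h (g \<theta>)\<close> may be positive.\<close>
  have fg: "f (g \<theta>) * (d * sin \<theta>) = h (g \<theta>)" if "0 < \<theta>" "\<theta> < pi" for \<theta>
  proof -
    have "d * sin \<theta> > 0" using that d by (simp add: sin_gt_zero)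
    then show ?thesis
      using sin_gt_zero[OF that] d by (simp add: f_def g_sin)
  qed
  have cont_hg: "continuous_on {0..pi} (\<lambda>\<theta>. h (g \<theta>))"
    by (rule continuous_on_compose2[OF cont])
      (use g_in in \<open>auto simp: g_def intro!: continuous_intros\<close>)
  have int_hg: "set_integrable lborel {0..pi} (\<lambda>\<theta>. h (g \<theta>))"
    using cont_hg by (rule borel_integrable_atLeastAtMost')
  have einterval: "einterval (ereal a) (ereal b) = {a<..<b}" for a b
    by (auto simp: einterval_def)
  have int_fg: "set_integrable lborel (einterval (ereal 0) (ereal pi)) (\<lambda>\<theta>. f (g \<theta>) * (d * sin \<theta>))"
  proof -
    have "set_integrable lborel {0<..<pi} (\<lambda>\<theta>. h (g \<theta>))"
      by (rule set_integrable_subset[OF int_hg]) auto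
    then show ?thesis
      unfolding einterval by (subst set_integrable_cong[OF refl refl fg]) auto
  qed
  have cont_f: "isCont f (g \<theta>)" if "0 < \<theta>" "\<theta> < pi" for \<theta>
  proof -
    have "isCont h (g \<theta>)"
      using continuous_on_interior[OF cont] g_int[OF that] by (simp add: interior_atLeastAtMost_real)
    moreover have "sqrt (d\<^sup>2 - (g \<theta> - m)\<^sup>2) \<noteq> 0"
      using that d sin_gt_zero[OF that] by (simp add: g_sin)
    ultimately show ?thesis
      unfolding f_def by (auto intro!: continuous_intros)
  qed
  have nonneg_f: "f (g \<theta>) \<ge> 0" for \<theta>
    using nonneg[OF g_in] by (auto simp: f_def g_sin)
  \<comment> \<open>The substitution rule takes its new bounds as limits in the extended reals; by
    continuity these are the values \<open>g 0\<close> and \<open>g pi\<close>.\<close>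
  have lim: "((ereal \<circ> g \<circ> real_of_ereal) \<longlongrightarrow> ereal (g a)) (at (ereal a) within S)" for a S
  proof -
    have "isCont g a" unfolding g_def by (intro continuous_intros)
    then have "((\<lambda>e. g (real_of_ereal e)) \<longlongrightarrow> g a) (at (ereal a) within S)"
      by (rule isCont_tendsto_compose) (rule lim_real_of_ereal, rule tendsto_ident_at)
    then show ?thesis by (simp add: comp_def)
  qed
  have deriv: "(g has_real_derivative d * sin \<theta>) (at \<theta>)" for \<theta>
    unfolding g_def by (auto intro!: derivative_eq_intros)
  have g'_nonneg: "d * sin \<theta> \<ge> 0" if "ereal 0 \<le> ereal \<theta>" "ereal \<theta> \<le> ereal pi" for \<theta>
    using that d by (simp add: sin_ge_zero)
  have cont_f': "isCont f (g \<theta>)" if "ereal 0 < ereal \<theta>" "ereal \<theta> < ereal pi" for \<theta>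
    using that by (intro cont_f) simp_all
  have cont_g': "isCont (\<lambda>\<theta>. d * sin \<theta>) \<theta>" for \<theta>
    by (intro continuous_intros)
  have "ereal 0 < ereal pi" by simp
  note subst = interval_integral_substitution_nonneg[OF this deriv cont_f' cont_g' nonneg_f
      g'_nonneg lim lim int_fg]
  from subst(1) show ?A
    by (simp add: einterval g_def f_def[abs_def])
  have "(LBINT t=ereal (g 0)..ereal (g pi). f t) =
      (LBINT \<theta>=ereal 0..ereal pi. f (g \<theta>) * (d * sin \<theta>))"
    by (rule subst(2))
  also have "\<dots> = (LBINT \<theta>=ereal 0..ereal pi. h (g \<theta>))"
    by (rule interval_integral_cong) (auto simp: einterval fg)
  also have "\<dots> = integral {0..pi} (\<lambda>\<theta>. h (g \<theta>))"
    using int_hg by (rule interval_integral_eq_integral[OF pi_ge_zero])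
  finally show ?B
    using d by (simp add: interval_integral_Ioo g_def f_def)
qed

section \<open>Binomial weights and their generating function on the unit circle\<close>

text \<open>The coefficient of \<open>z ^ k\<close> in the expansion of
  \<open>(1 + y + y * z) powr \<alpha>\<close> in powers of \<open>z\<close>. For
  \<open>\<alpha> = - n / c\<close> and \<open>y = c * x\<close> it is
  \<open>p_basis c n k x\<close> up to the sign \<open>(- 1) ^ k\<close>, which squaring
  removes.\<close>

definition binomial_weight :: "real \<Rightarrow> real \<Rightarrow> nat \<Rightarrow> real" where
  "binomial_weight \<alpha> y k = (\<alpha> gchoose k) * y ^ k * rpow (1 + y) (\<alpha> - real k)"

lemma norm_square_on_circle:
  "(norm (of_real (1 + y) + of_real y * cis \<theta>))\<^sup>2 = 1 + 2 * y * (1 + y) * (1 + cos \<theta>)"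
proof -
  have "(norm (of_real (1 + y) + of_real y * cis \<theta>))\<^sup>2 =
      (1 + y + y * cos \<theta>)\<^sup>2 + (y * sin \<theta>)\<^sup>2"
    by (simp add: cmod_power2)
  also have "\<dots> = 1 + 2 * y * (1 + y) * (1 + cos \<theta>)"
    by (simp add: power_mult_distrib sin_squared_eq) (simp add: power2_eq_square algebra_simps)
  finally show ?thesis .
qed

lemma binomial_weight_eq:
  assumes "1 + y > 0"
  shows "binomial_weight \<alpha> y k = (1 + y) powr \<alpha> * ((\<alpha> gchoose k) * (y / (1 + y)) ^ k)"
  using assms by (simp add: binomial_weight_def rpow_def powr_diff powr_realpow power_divide)

text \<open>This stays valid at \<open>1 + y = 0\<close>: for \<open>k = l\<close> the convention in
  \<open>rpow\<close> gives 1, and for \<open>k > l\<close> the vanishing binomial coefficient hides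
  both the negative exponent and the truncated \<open>l - k\<close>.\<close>

lemma binomial_weight_nat:
  assumes "1 + y \<ge> 0"
  shows "binomial_weight (real l) y k = real (l choose k) * y ^ k * (1 + y) ^ (l - k)"
proof (cases "k \<le> l")
  case True
  show ?thesis
  proof (cases "k = l")
    case False
    with True have "rpow (1 + y) (real l - real k) = (1 + y) ^ (l - k)"
      using assms powr_realpow'[of "1 + y" "l - k"] by (simp add: rpow_def of_nat_diff)
    then show ?thesis
      by (simp add: binomial_weight_def binomial_gbinomial)
  qed (simp add: binomial_weight_def rpow_def flip: binomial_gbinomial)
next
  case False
  then show ?thesis
    by (simp add: binomial_weight_def flip: binomial_gbinomial)
qed

lemma summable_abs_gbinomial_series:
  fixes r \<alpha> :: real
  assumes "\<bar>r\<bar> < 1"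
  shows "summable (\<lambda>k. \<bar>(\<alpha> gchoose k) * r ^ k\<bar>)"
proof -
  \<comment> \<open>A power series converges absolutely strictly inside a point of convergence;
    \<open>R\<close> is such a point.\<close>
  obtain R where R: "\<bar>r\<bar> < R" "R < 1" using dense[OF assms] by blast
  then have "summable (\<lambda>k. (\<alpha> gchoose k) * R ^ k)"
    using gen_binomial_real[of R \<alpha>] by (simp add: sums_iff)
  then have "summable (\<lambda>k. norm ((\<alpha> gchoose k) * r ^ k))"
    by (rule powser_insidea) (use R in simp)
  then show ?thesis by simp
qed

text \<open>For \<open>y \<ge> 0\<close> the ratio \<open>r = y / (1 + y)\<close> is below 1, so the
  binomial series of \<open>(1 + r * z) powr \<alpha>\<close> converges absolutely on the whole unit
  circle, for any real exponent.\<close>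

lemma binomial_weight_pos:
  assumes y: "y \<ge> 0"
  shows "summable (\<lambda>k. \<bar>binomial_weight \<alpha> y k\<bar>)" (is ?A)
    and "(\<lambda>N. (norm (\<Sum>k<N. of_real (binomial_weight \<alpha> y k) * cis \<theta> ^ k))\<^sup>2)
      \<longlonglongrightarrow> (1 + 2 * y * (1 + y) * (1 + cos \<theta>)) powr \<alpha>" (is ?B)
proof -
  define r where "r = y / (1 + y)"
  have r: "\<bar>r\<bar> < 1" using y by (simp add: r_def)
  have b: "binomial_weight \<alpha> y k = (1 + y) powr \<alpha> * ((\<alpha> gchoose k) * r ^ k)" for k
    using y by (simp add: binomial_weight_eq r_def)
  show ?A
    unfolding b abs_mult[of "(1 + y) powr \<alpha>"]
    by (intro summable_mult summable_abs_gbinomial_series r)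
  define z where "z = of_real r * cis \<theta>"
  have "norm z < 1" using r by (simp add: z_def norm_mult)
  then have "(\<lambda>k. of_real ((1 + y) powr \<alpha>) * ((of_real \<alpha> gchoose k) * z ^ k)) sums
      (of_real ((1 + y) powr \<alpha>) * (1 + z) powr of_real \<alpha>)"
    by (intro sums_mult gen_binomial_complex)
  also have "(\<lambda>k. of_real ((1 + y) powr \<alpha>) * ((of_real \<alpha> gchoose k) * z ^ k)) =
      (\<lambda>k. of_real (binomial_weight \<alpha> y k) * cis \<theta> ^ k)"
    by (simp add: b z_def power_mult_distrib gbinomial_prod_rev mult_ac)
  finally have "(\<lambda>N. (norm (\<Sum>k<N. of_real (binomial_weight \<alpha> y k) * cis \<theta> ^ k))\<^sup>2) \<longlonglongrightarrow>
      (norm (of_real ((1 + y) powr \<alpha>) * (1 + z) powr of_real \<alpha>))\<^sup>2"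
    unfolding sums_def by (intro tendsto_intros)
  \<comment> \<open>For a real exponent the modulus of a complex power is the power of the modulus,
    so the branch does not matter and \<open>1 + y\<close> can be absorbed into the base.\<close>
  also have "norm (of_real ((1 + y) powr \<alpha>) * (1 + z) powr of_real \<alpha>) =
      ((1 + y) * norm (1 + z)) powr \<alpha>"
    using y by (simp add: norm_mult norm_powr_real_powr' powr_mult)
  also have "(1 + y) * norm (1 + z) = norm (of_real (1 + y) * (1 + z))"
    using y by (simp only: norm_mult norm_of_real)
  also have "of_real (1 + y) * (1 + z) = of_real (1 + y) + of_real y * cis \<theta>"
  proof -
    have "(1 + y) * r = y" using y by (simp add: r_def)
    then have "complex_of_real (1 + y) * of_real r = of_real y" by (metis of_real_mult)
    then show ?thesis by (simp add: z_def distrib_left flip: mult.assoc)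
  qed
  also have "(norm (of_real (1 + y) + of_real y * cis \<theta>) powr \<alpha>)\<^sup>2 =
      ((norm (of_real (1 + y) + of_real y * cis \<theta>))\<^sup>2) powr \<alpha>"
    by (simp add: power2_eq_square powr_mult)
  finally show ?B
    by (simp only: norm_square_on_circle)
qed

text \<open>Here \<open>y / (1 + y)\<close> may be large or undefined, but the exponent is a natural
  number: the expansion is the finite binomial theorem.\<close>

lemma binomial_weight_neg:
  assumes y: "y \<in> {-1..0}" and l: "l \<ge> 1"
  shows "summable (\<lambda>k. \<bar>binomial_weight (real l) y k\<bar>)" (is ?A)
    and "(\<lambda>N. (norm (\<Sum>k<N. of_real (binomial_weight (real l) y k) * cis \<theta> ^ k))\<^sup>2)
      \<longlonglongrightarrow> (1 + 2 * y * (1 + y) * (1 + cos \<theta>)) powr real l" (is ?B)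
proof -
  have b: "binomial_weight (real l) y k = real (l choose k) * y ^ k * (1 + y) ^ (l - k)" for k
    using y by (intro binomial_weight_nat) simp
  have fin: "binomial_weight (real l) y k = 0" if "k \<notin> {..l}" for k
    using that by (auto simp: b)
  show ?A
    by (rule summable_finite[of "{..l}"]) (auto simp: fin)
  have "(\<lambda>k. of_real (binomial_weight (real l) y k) * cis \<theta> ^ k) sums
      (\<Sum>k\<le>l. of_real (binomial_weight (real l) y k) * cis \<theta> ^ k)"
    by (rule sums_finite) (auto simp: fin)
  also have "(\<Sum>k\<le>l. of_real (binomial_weight (real l) y k) * cis \<theta> ^ k) =
      (of_real y * cis \<theta> + of_real (1 + y)) ^ l"
    unfolding binomial_ring[of "of_real y * cis \<theta>"]
    by (intro sum.cong refl) (simp add: b power_mult_distrib mult_ac)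
  finally have "(\<lambda>N. (norm (\<Sum>k<N. of_real (binomial_weight (real l) y k) * cis \<theta> ^ k))\<^sup>2) \<longlonglongrightarrow>
      (norm ((of_real y * cis \<theta> + of_real (1 + y)) ^ l))\<^sup>2"
    unfolding sums_def by (intro tendsto_intros)
  also have "(norm ((of_real y * cis \<theta> + of_real (1 + y)) ^ l))\<^sup>2 =
      ((norm (of_real (1 + y) + of_real y * cis \<theta>))\<^sup>2) ^ l"
    by (simp only: norm_power add.commute[of "of_real y * cis \<theta>"] mult.commute[of l 2] flip: power_mult)
  \<comment> \<open>The base can vanish (\<open>y = - 1 / 2\<close>, \<open>\<theta> = 0\<close>),
    where \<open>^\<close> and \<open>powr\<close> agree only because
    \<open>l \<ge> 1\<close>.\<close>
  also have "\<dots> = ((norm (of_real (1 + y) + of_real y * cis \<theta>))\<^sup>2) powr real l"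
    using l by (intro powr_realpow'[symmetric]) auto
  finally show ?B
    by (simp only: norm_square_on_circle)
qed

section \<open>Series and hypergeometric forms for nonzero \<open>c\<close>\<close>

lemma p_basis_square:
  assumes "c \<noteq> 0"
  shows "(p_basis c n k x)\<^sup>2 = (binomial_weight (- n / c) (c * x) k)\<^sup>2"
  using assms by (simp add: p_basis_def binomial_weight_def power_mult_distrib flip: power_mult)

lemma series_coeff_eq_pochhammer:
  assumes "c \<noteq> 0"
  shows "series_coeff c n k = c ^ k * pochhammer (n / c) k / fact k"
proof -
  have "(\<Prod>i<k. n + real i * c) = (\<Prod>i<k. c * (n / c + real i))"
    using assms by (intro prod.cong) (auto simp: field_simps)
  then show ?thesis
    by (simp add: series_coeff_def pochhammer_prod prod.distrib lessThan_atLeast0)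
qed

lemma p_basis_square_eq_series_term:
  assumes "c \<noteq> 0" and "1 + c * x > 0"
  shows "(p_basis c n k x)\<^sup>2 =
    (1 + c * x) powr (- 2 * n / c) * ((series_coeff c n k)\<^sup>2 * (x / (1 + c * x)) ^ (2 * k))"
proof -
  have "(p_basis c n k x)\<^sup>2 = ((1 + c * x) powr (- n / c) *
      (((- n / c) gchoose k) * (c * x / (1 + c * x)) ^ k))\<^sup>2"
    using assms by (simp only: p_basis_square binomial_weight_eq not_False_eq_True)
  also have "\<dots> = ((1 + c * x) powr (- n / c))\<^sup>2 *
      ((pochhammer (n / c) k * c ^ k / fact k) * (x / (1 + c * x)) ^ k)\<^sup>2"
    by (simp add: gbinomial_pochhammer power_mult_distrib power_divide flip: power_mult)
  also have "((1 + c * x) powr (- n / c))\<^sup>2 = (1 + c * x) powr (- 2 * n / c)"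
    by (simp add: power2_eq_square flip: powr_add)
  also have "pochhammer (n / c) k * c ^ k / fact k = series_coeff c n k"
    using assms by (simp add: series_coeff_eq_pochhammer mult.commute)
  finally show ?thesis
    by (simp only: power_mult_distrib power_even_eq)
qed

lemma hypergeo_term_eq:
  assumes "c \<noteq> 0"
  shows "fps_nth (fps_hypergeo [n / c, n / c] [1] 1) k * ((c * x / (1 + c * x))\<^sup>2) ^ k =
    (series_coeff c n k)\<^sup>2 * (x / (1 + c * x)) ^ (2 * k)"
proof -
  have "((c * x / (1 + c * x))\<^sup>2) ^ k = c ^ (2 * k) * (x / (1 + c * x)) ^ (2 * k)"
    by (simp add: power_mult power_mult_distrib power_divide)
  then show ?thesis
    using assms by (simp add: series_coeff_eq_pochhammer pochhammer_fact[symmetric]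
        power2_eq_square mult_2 power_add)
qed

text \<open>The terms agree one by one, since \<open>pochhammer 1 k = fact k\<close>. This holds for
  every \<open>x\<close>, even at \<open>- 1 / c\<close>, where the quotients default to 0, so
  convergence and limits carry over from one form to the other.\<close>

lemma hyp_rhs_eq_series_rhs:
  assumes "c \<noteq> 0"
  shows "hyp_rhs c n x = series_rhs c n x"
  unfolding hyp_rhs_def series_rhs_def hyp_2F1_def eval_fps_def hypergeo_term_eq[OF assms] ..

section \<open>Integral form for nonzero \<open>c\<close>\<close>

lemma S_sum_binomial_integral:
  fixes c n x :: real
  assumes c: "c \<noteq> 0"
    and conv: "summable (\<lambda>k. \<bar>binomial_weight (- n / c) (c * x) k\<bar>)"
      "\<And>\<theta>. (\<lambda>N. (norm (\<Sum>k<N. of_real (binomial_weight (- n / c) (c * x) k) * cis \<theta> ^ k))\<^sup>2)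
        \<longlonglongrightarrow> (1 + 2 * (c * x) * (1 + c * x) * (1 + cos \<theta>)) powr (- n / c)"
    and pos: "0 \<le> c * x \<or> 0 < - n / c"
  shows "summable (\<lambda>k. (p_basis c n k x)\<^sup>2)"
    and "set_integrable lborel {0<..<1}
      (\<lambda>t. (t + (1 - t) * (1 + 2 * c * x)\<^sup>2) powr (- n / c) * (1 / sqrt (t * (1 - t))))" (is ?I)
    and "S_sum c n x = 1 / pi * (LBINT t:{0<..<1}.
      (t + (1 - t) * (1 + 2 * c * x)\<^sup>2) powr (- n / c) * (1 / sqrt (t * (1 - t))))" (is "_ = ?J")
proof -
  define h where "h t = (t + (1 - t) * (1 + 2 * c * x)\<^sup>2) powr (- n / c)" for t
  have base: "1 \<le> t + (1 - t) * (1 + 2 * c * x)\<^sup>2" if "0 \<le> c * x" "t \<in> {0..1}" for t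
  proof -
    have "1 \<le> (1 + 2 * c * x)\<^sup>2" using that by (intro one_le_power) simp
    then have "(1 - t) * 1 \<le> (1 - t) * (1 + 2 * c * x)\<^sup>2" using that by (intro mult_left_mono) auto
    then show ?thesis by simp
  qed
  \<comment> \<open>The interval is \<open>{0..1}\<close>, written with midpoint and half-length 1/2
    to fit the substitution. By \<open>pos\<close>, either the base is at least 1 or the exponent is
    positive, so a zero base does no harm.\<close>
  have "continuous_on {1 / 2 - 1 / 2..1 / 2 + 1 / 2} h"
    unfolding h_def using pos base by (intro continuous_on_powr' continuous_intros) force+
  note arcsine = arcsine_substitution[OF _ this, unfolded h_def]
  have weight: "(1 / 2)\<^sup>2 - (t - 1 / 2)\<^sup>2 = t * (1 - t)" for t :: real
    by (simp add: power2_eq_square algebra_simps)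
  show ?I
    using arcsine(1) by (simp add: weight)
  \<comment> \<open>With \<open>y = c * x\<close> the base is
    \<open>1 + 4 * y * (1 + y) * (1 - t)\<close>, and
    \<open>1 - t = (1 + cos \<theta>) / 2\<close>.\<close>
  have "h (1 / 2 - 1 / 2 * cos \<theta>) = (1 + 2 * (c * x) * (1 + c * x) * (1 + cos \<theta>)) powr (- n / c)" for \<theta>
    unfolding h_def by (rule arg_cong[of _ _ "\<lambda>b. b powr _"]) (simp add: power2_eq_square field_simps)
  then have integral: "integral {0..pi} (\<lambda>\<theta>. (1 + 2 * (c * x) * (1 + c * x) * (1 + cos \<theta>)) powr (- n / c)) =
      (LBINT t:{0<..<1}.
        (t + (1 - t) * (1 + 2 * c * x)\<^sup>2) powr (- n / c) * (1 / sqrt (t * (1 - t))))"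
    using arcsine(2) by (simp add: weight h_def)
  have "(\<lambda>k. (p_basis c n k x)\<^sup>2) sums ?J"
    using parseval_sums[OF conv(1) conv(2)] unfolding integral p_basis_square[OF c] .
  then show "summable (\<lambda>k. (p_basis c n k x)\<^sup>2)" "S_sum c n x = ?J"
    by (auto simp: sums_iff S_sum_def)
qed

text \<open>For \<open>c > 0\<close> one has \<open>c * x \<ge> 0\<close> and the infinite expansion
  applies; for \<open>c < 0\<close>, \<open>c * x\<close> lies in \<open>{-1..0}\<close> and
  \<open>- n / c\<close> is a positive integer, so the finite one does.\<close>

lemma binomial_weight_conv:
  fixes c n x :: real
  assumes n: "n > 0" and c: "c \<noteq> 0" and l: "c < 0 \<Longrightarrow> \<exists>l::nat. l \<ge> 1 \<and> n = - c * real l"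
    and x: "x \<in> I_dom c"
  shows "summable (\<lambda>k. \<bar>binomial_weight (- n / c) (c * x) k\<bar>)"
    and "(\<lambda>N. (norm (\<Sum>k<N. of_real (binomial_weight (- n / c) (c * x) k) * cis \<theta> ^ k))\<^sup>2)
      \<longlonglongrightarrow> (1 + 2 * (c * x) * (1 + c * x) * (1 + cos \<theta>)) powr (- n / c)"
    and "0 \<le> c * x \<or> 0 < - n / c"
proof -
  consider "c > 0" "c * x \<ge> 0"
    | l where "c < 0" "l \<ge> 1" "- n / c = real l" "c * x \<in> {-1..0}"
  proof (cases "c > 0")
    case True
    then show ?thesis using x that(1) by (auto simp: I_dom_def)
  next
    case False
    with c have "c < 0" by simp
    with l obtain l where "l \<ge> 1" "n = - c * real l" by blast
    with \<open>c < 0\<close> x show ?thesis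
      by (intro that(2)[of l]) (auto simp: I_dom_def field_simps mult_nonpos_nonneg)
  qed
  note cases = this
  show "summable (\<lambda>k. \<bar>binomial_weight (- n / c) (c * x) k\<bar>)"
    by (cases rule: cases) (simp_all only: binomial_weight_pos binomial_weight_neg)
  show "(\<lambda>N. (norm (\<Sum>k<N. of_real (binomial_weight (- n / c) (c * x) k) * cis \<theta> ^ k))\<^sup>2)
      \<longlonglongrightarrow> (1 + 2 * (c * x) * (1 + c * x) * (1 + cos \<theta>)) powr (- n / c)"
    by (cases rule: cases) (simp_all only: binomial_weight_pos binomial_weight_neg)
  show "0 \<le> c * x \<or> 0 < - n / c"
    by (cases rule: cases) auto
qed

lemma one_plus_pos_of_I_dom:
  assumes "c \<noteq> 0" "x \<in> I_dom c" "x \<noteq> - 1 / c"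
  shows "1 + c * x > 0"
proof (cases "c < 0")
  case True
  then have "x < - 1 / c" using assms by (simp add: I_dom_def)
  with True show ?thesis by (simp add: field_simps)
next
  case False
  with assms have "c * x \<ge> 0" by (simp add: I_dom_def)
  then show ?thesis by simp
qed

section \<open>Convergence of the series and the limit at the right endpoint\<close>

lemma S_sum_eq_series_rhs:
  assumes c: "c \<noteq> 0" and pos: "1 + c * x > 0" and sum: "summable (\<lambda>k. (p_basis c n k x)\<^sup>2)"
  shows "summable (\<lambda>k. (series_coeff c n k)\<^sup>2 * (x / (1 + c * x)) ^ (2 * k))"
    and "S_sum c n x = series_rhs c n x"
proof -
  show *: "summable (\<lambda>k. (series_coeff c n k)\<^sup>2 * (x / (1 + c * x)) ^ (2 * k))"
    using sum pos by (simp add: p_basis_square_eq_series_term[OF c pos] summable_cmult_iff)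
  show "S_sum c n x = series_rhs c n x"
    unfolding S_sum_def series_rhs_def p_basis_square_eq_series_term[OF c pos]
    by (rule suminf_mult[OF *])
qed

lemma continuous_on_S_sum:
  assumes c: "c < 0" and l: "n = - c * real l"
  shows "continuous_on (I_dom c) (S_sum c n)"
proof -
  have "- n / c = real l" using c l by simp
  moreover have "1 + c * x \<ge> 0" if "x \<in> I_dom c" for x
    using that c by (auto simp: I_dom_def field_simps)
  ultimately have p: "(p_basis c n k x)\<^sup>2 =
      (real (l choose k) * (c * x) ^ k * (1 + c * x) ^ (l - k))\<^sup>2" if "x \<in> I_dom c" for k x
    using c that by (simp add: p_basis_square binomial_weight_nat)
  have "S_sum c n x = (\<Sum>k\<le>l. (real (l choose k) * (c * x) ^ k * (1 + c * x) ^ (l - k))\<^sup>2)"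
    if "x \<in> I_dom c" for x
    unfolding S_sum_def p[OF that] by (rule suminf_finite) auto
  then show ?thesis
    by (subst continuous_on_cong[OF refl]) (auto intro!: continuous_intros)
qed

text \<open>For \<open>c < 0\<close> the sum is a polynomial on \<open>I_dom c\<close>, endpoint
  included, hence continuous there. A limit ignores the value of \<open>f\<close> at the point
  itself, so agreement elsewhere is enough.\<close>

lemma S_sum_limit:
  assumes c: "c < 0" and l: "n = - c * real l"
    and eq: "\<And>x. x \<in> I_dom c \<Longrightarrow> x \<noteq> - 1 / c \<Longrightarrow> S_sum c n x = f x"
  shows "(f \<longlongrightarrow> S_sum c n (- 1 / c)) (at (- 1 / c) within I_dom c)"
proof -
  have "- 1 / c \<in> I_dom c" using c by (auto simp: I_dom_def)
  then have "(S_sum c n \<longlongrightarrow> S_sum c n (- 1 / c)) (at (- 1 / c) within I_dom c)"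
    using continuous_on_S_sum[OF c l] by (simp add: continuous_on_def)
  then show ?thesis
    by (rule Lim_transform_eventually) (auto simp: eventually_at_filter eq)
qed

section \<open>The case \<open>c = 0\<close>\<close>

text \<open>The generating function is \<open>exp (n * x * (z - 1))\<close>, entire in
  \<open>z\<close>, so no restriction on \<open>x\<close> arises. Its squared modulus on the circle
  is \<open>exp (- 2 * n * x * (1 - cos \<theta>))\<close>.\<close>

lemma S_sum_0_integral:
  fixes n x :: real
  shows "summable (\<lambda>k. (p_basis 0 n k x)\<^sup>2)"
    and "set_integrable lborel {-1<..<1}
           (\<lambda>t. exp (- 2 * n * x * (1 + t)) * (1 / sqrt (1 - t\<^sup>2)))" (is ?I)
    and "S_sum 0 n x = 1 / pi * (LBINT t:{-1<..<1}.
      exp (- 2 * n * x * (1 + t)) * (1 / sqrt (1 - t\<^sup>2)))" (is "_ = ?J")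
proof -
  have p: "p_basis 0 n k x = exp (- (n * x)) * ((n * x) ^ k /\<^sub>R fact k)" for k
    by (simp add: p_basis_def field_simps)
  have "summable (\<lambda>k. exp (- (n * x)) * norm ((n * x) ^ k /\<^sub>R fact k))"
    by (intro summable_mult summable_norm_exp)
  then have sum: "summable (\<lambda>k. \<bar>p_basis 0 n k x\<bar>)"
    unfolding p by (simp add: abs_mult)
  \<comment> \<open>The form \<open>0 - 1 * cos \<theta>\<close> matches the substitution with
    \<open>m = 0\<close> and \<open>d = 1\<close>.\<close>
  have lim: "(\<lambda>N. (norm (\<Sum>k<N. of_real (p_basis 0 n k x) * cis \<theta> ^ k))\<^sup>2) \<longlonglongrightarrow>
      exp (- 2 * n * x * (1 + (0 - 1 * cos \<theta>)))" for \<theta>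
  proof -
    define z where "z = of_real (n * x) * cis \<theta>"
    have "(\<lambda>k. of_real (exp (- (n * x))) * (z ^ k /\<^sub>R fact k)) sums (of_real (exp (- (n * x))) * exp z)"
      by (intro sums_mult exp_converges)
    also have "(\<lambda>k. of_real (exp (- (n * x))) * (z ^ k /\<^sub>R fact k)) =
        (\<lambda>k. of_real (p_basis 0 n k x) * cis \<theta> ^ k)"
      by (simp add: p z_def power_mult_distrib scaleR_conv_of_real mult_ac)
    finally have "(\<lambda>N. (norm (\<Sum>k<N. of_real (p_basis 0 n k x) * cis \<theta> ^ k))\<^sup>2) \<longlonglongrightarrow>
        (norm (of_real (exp (- (n * x))) * exp z))\<^sup>2"
      unfolding sums_def by (intro tendsto_intros)
    also have "(norm (of_real (exp (- (n * x))) * exp z))\<^sup>2 = exp (- 2 * n * x * (1 + (0 - 1 * cos \<theta>)))"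
      by (simp add: norm_mult z_def power2_eq_square algebra_simps flip: exp_add)
    finally show ?thesis .
  qed
  have "continuous_on {0 - 1..0 + 1} (\<lambda>t. exp (- 2 * n * x * (1 + t)))"
    by (intro continuous_intros)
  note arcsine = arcsine_substitution[OF zero_less_one this]
  show ?I
    using arcsine(1) by simp
  have "(\<lambda>k. (p_basis 0 n k x)\<^sup>2) sums ?J"
    using parseval_sums[OF sum lim] arcsine(2) by simp
  then show "summable (\<lambda>k. (p_basis 0 n k x)\<^sup>2)" "S_sum 0 n x = ?J"
    by (auto simp: sums_iff S_sum_def)
qed

lemma S_sum_0_series:
  fixes n x :: real
  shows "summable (\<lambda>k. (n * x) ^ (2 * k) / (fact k)\<^sup>2)"
    and "S_sum 0 n x = exp (- 2 * n * x) * (\<Sum>k. (n * x) ^ (2 * k) / (fact k)\<^sup>2)"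
proof -
  have p: "(p_basis 0 n k x)\<^sup>2 = exp (- 2 * n * x) * ((n * x) ^ (2 * k) / (fact k)\<^sup>2)" for k
  proof -
    have "(exp (- (n * x)))\<^sup>2 = exp (- 2 * n * x)"
      by (simp add: power2_eq_square flip: exp_add)
    then show ?thesis
      by (simp add: p_basis_def power_mult_distrib power_divide power_even_eq)
  qed
  show *: "summable (\<lambda>k. (n * x) ^ (2 * k) / (fact k)\<^sup>2)"
    \<comment> \<open>The exponential factor is nonzero, so it can be cancelled from the summable
      squares.\<close>
    using S_sum_0_integral(1)[of n x] unfolding p summable_cmult_iff by simp
  show "S_sum 0 n x = exp (- 2 * n * x) * (\<Sum>k. (n * x) ^ (2 * k) / (fact k)\<^sup>2)"
    unfolding S_sum_def p by (rule suminf_mult[OF *])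
qed

theorem theorem3p1:
  fixes c n :: real
  assumes "n > 0"
    and "c \<ge> 0 \<Longrightarrow> n > c"
    and "c < 0 \<Longrightarrow> \<exists>l::nat. l \<ge> 1 \<and> n = - c * real l"
  shows "(\<forall>x\<in>I_dom c. summable (\<lambda>k. (p_basis c n k x)\<^sup>2)) \<and>
    (c \<noteq> 0 \<longrightarrow>
      (\<forall>x\<in>I_dom c. x \<noteq> - 1 / c \<longrightarrow>
         summable (\<lambda>k. (series_coeff c n k)\<^sup>2 * (x / (1 + c * x)) ^ (2 * k)) \<and>
         S_sum c n x = series_rhs c n x) \<and>
      (\<forall>x\<in>I_dom c. x \<noteq> - 1 / c \<longrightarrow>
         summable (\<lambda>k. fps_nth (fps_hypergeo [n / c, n / c] [1] 1) k *
                       ((c * x / (1 + c * x))\<^sup>2) ^ k) \<and>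
         S_sum c n x = hyp_rhs c n x) \<and>
      (c < 0 \<longrightarrow>
         (series_rhs c n \<longlongrightarrow> S_sum c n (- 1 / c)) (at (- 1 / c) within I_dom c) \<and>
         (hyp_rhs c n \<longlongrightarrow> S_sum c n (- 1 / c)) (at (- 1 / c) within I_dom c)) \<and>
      (\<forall>x\<in>I_dom c.
         set_integrable lborel {0<..<1}
           (\<lambda>t. (t + (1 - t) * (1 + 2 * c * x)\<^sup>2) powr (- n / c) * (1 / sqrt (t * (1 - t)))) \<and>
         S_sum c n x =
           1 / pi * (LBINT t:{0<..<1}.
             (t + (1 - t) * (1 + 2 * c * x)\<^sup>2) powr (- n / c) * (1 / sqrt (t * (1 - t)))))) \<and>
    (c = 0 \<longrightarrow>
      (\<forall>x\<in>I_dom 0.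
         summable (\<lambda>k. (n * x) ^ (2 * k) / (fact k)\<^sup>2) \<and>
         S_sum 0 n x = exp (- 2 * n * x) * (\<Sum>k. (n * x) ^ (2 * k) / (fact k)\<^sup>2)) \<and>
      (\<forall>x\<in>I_dom 0. S_sum 0 n x = exp (- 2 * n * x) * bessel_I0 (2 * n * x)) \<and>
      (\<forall>x\<in>I_dom 0.
         set_integrable lborel {-1<..<1}
           (\<lambda>t. exp (- 2 * n * x * (1 + t)) * (1 / sqrt (1 - t\<^sup>2))) \<and>
         S_sum 0 n x =
           1 / pi * (LBINT t:{-1<..<1}.
             exp (- 2 * n * x * (1 + t)) * (1 / sqrt (1 - t\<^sup>2)))))"
proof (cases "c = 0")
  case True
  have "bessel_I0 (2 * n * x) = (\<Sum>k. (n * x) ^ (2 * k) / (fact k)\<^sup>2)" for x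
    by (simp add: bessel_I0_def)
  then show ?thesis
    using True S_sum_0_integral S_sum_0_series by simp
next
  case False
  note weight = binomial_weight_conv[OF assms(1) False assms(3)]
  have S: "summable (\<lambda>k. (p_basis c n k x)\<^sup>2)"
    "set_integrable lborel {0<..<1}
      (\<lambda>t. (t + (1 - t) * (1 + 2 * c * x)\<^sup>2) powr (- n / c) * (1 / sqrt (t * (1 - t))))"
    "S_sum c n x = 1 / pi * (LBINT t:{0<..<1}.
      (t + (1 - t) * (1 + 2 * c * x)\<^sup>2) powr (- n / c) * (1 / sqrt (t * (1 - t))))"
    if "x \<in> I_dom c" for x
    using that by (intro S_sum_binomial_integral[OF False] weight; simp)+
  have series: "summable (\<lambda>k. (series_coeff c n k)\<^sup>2 * (x / (1 + c * x)) ^ (2 * k))"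
    "S_sum c n x = series_rhs c n x" if "x \<in> I_dom c" "x \<noteq> - 1 / c" for x
    using S_sum_eq_series_rhs[OF False one_plus_pos_of_I_dom[OF False that] S(1)] that by auto
  have limit: "(series_rhs c n \<longlongrightarrow> S_sum c n (- 1 / c)) (at (- 1 / c) within I_dom c)" if "c < 0"
    using assms(3)[OF that] S_sum_limit[OF that _ series(2)] by blast
  have hyp: "hyp_rhs c n = series_rhs c n"
    using hyp_rhs_eq_series_rhs[OF False] by blast
  show ?thesis
    \<comment> \<open>This turns the hypergeometric claims into literal copies of the series
      claims.\<close>
    unfolding hypergeo_term_eq[OF False] hyp
    using False by (intro conjI impI ballI S series limit) simp_all
qed

end
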